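(* Let $n\geq 1$ be an integer. For $\alpha\in[2,\infty)$ and $\xi=(\xi_1,\dots,\xi_n)\in\mathbb{R}^n$ define $$o^{\mathrm{p}}(\xi;\alpha)=\Bigl(\frac1n\sum_{i=1}^n|\xi_i|^\alpha\Bigr)^{1/\alpha},\qquad \mathcal{O}^{\mathrm{p}}(\alpha)=\{\xi\in\mathbb{R}^n \mid o^{\mathrm{p}}(\xi;\alpha)\leq 1\},$$ and let $\mathcal{B}=\{\xi\in\mathbb{R}^n\mid \|\xi\|_\infty\leq 1\}$. Then: (i) for every $\alpha\in[2,\infty)$, the function $\xi\mapsto o^{\mathrm{p}}(\xi;\alpha)$ is convex on $\mathbb{R}^n$; (ii) the sets $\mathcal{O}^{\mathrm{p}}(\alpha)$ are over-approximations of $\mathcal{B}$, i.e. $\mathcal{B}\subseteq \mathcal{O}^{\mathrm{p}}(\alpha)$ for every $\alpha\in[2,\infty)$; (iii) the sets $\mathcal{O}^{\mathrm{p}}(\alpha)$ are monotonously tightening in $\alpha$, i.e. $\mathcal{O}^{\mathrm{p}}(\alpha_2)\subseteq\mathcal{O}^{\mathrm{p}}(\alpha_1)$ for all $\alpha_1,\alpha_2\in[2,\infty)$ with $\alpha_2\geq\alpha_1$.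
   Context: Here $\|\xi\|_\infty=\max_i|\xi_i|$. The terms "over-approximation" and "monotonously tightening" mean exactly the set inclusions written in the claim. *)

theory Defs
  imports "HOL-Analysis.Analysis"
begin

(* The dimension n is CARD('n), hence n >= 1 holds automatically.
   Only exponents \<alpha> >= 2 are intended, and there 0 powr \<alpha> = 0 and
   0 powr (1 / \<alpha>) = 0 agree with the usual real powers at base 0. *)
definition op_fun :: "real \<Rightarrow> real ^ 'n \<Rightarrow> real" where
  "op_fun \<alpha> \<xi> =
     ((1 / real CARD('n)) * (\<Sum>i\<in>UNIV. \<bar>\<xi> $ i\<bar> powr \<alpha>)) powr (1 / \<alpha>)"

definition Op_set :: "real \<Rightarrow> (real ^ 'n) set" where
  "Op_set \<alpha> = {\<xi>. op_fun \<alpha> \<xi> \<le> 1}"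

definition unit_box :: "(real ^ 'n) set" where
  "unit_box = {\<xi>. infnorm \<xi> \<le> 1}"

end

theory Submission
  imports Defs
begin

text \<open>
  Write \<open>M\<^sub>\<alpha>(x)\<close> for the mean of \<open>\<bar>x\<^sub>i\<bar>\<^sup>\<alpha>\<close>. As \<open>M\<^sub>\<alpha>\<close> is convex, so is its sublevel set
  \<open>M\<^sub>\<alpha> \<le> 1\<close>, and \<open>op_fun \<alpha>\<close> is the gauge of this set; the gauge of a convex set is convex.
  The sublevel sets shrink in \<open>\<alpha>\<close> because the weighted AM-GM inequality gives
  \<open>t\<^sup>\<alpha> \<le> (\<alpha>/\<beta>) t\<^sup>\<beta> + 1 - \<alpha>/\<beta>\<close> for \<open>\<alpha> \<le> \<beta>\<close>.
\<close>

definition mean_powr :: "real \<Rightarrow> real ^ 'n \<Rightarrow> real" where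
  "mean_powr p x = (\<Sum>i\<in>UNIV. \<bar>x $ i\<bar> powr p) / real CARD('n)"

lemma mean_powr_nonneg: "0 \<le> mean_powr p x"
  by (simp add: mean_powr_def sum_nonneg)

lemma op_fun_eq_mean_powr: "op_fun p x = mean_powr p x powr (1 / p)"
  by (simp add: op_fun_def mean_powr_def)

text \<open>Powers with a positive exponent preserve the bound 1 on nonnegative numbers. This
  removes the outer root, so that sublevel sets can be studied through
  \<open>mean_powr\<close>.\<close>

lemma op_fun_le_1_iff:
  assumes "p > 0"
  shows "op_fun p x \<le> 1 \<longleftrightarrow> mean_powr p x \<le> 1"
proof
  assume "op_fun p x \<le> 1"
  then have "(mean_powr p x powr (1 / p)) powr p \<le> 1"
    using assms by (intro powr_le1) (auto simp: op_fun_eq_mean_powr)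
  then show "mean_powr p x \<le> 1"
    using assms mean_powr_nonneg[of p x] by (simp add: powr_powr)
next
  assume "mean_powr p x \<le> 1"
  then show "op_fun p x \<le> 1"
    using assms mean_powr_nonneg[of p x] by (auto simp: op_fun_eq_mean_powr intro!: powr_le1)
qed

text \<open>Homogeneity makes \<open>op_fun\<close> the gauge of its unit sublevel set: for a > 0,
  the bound \<open>op_fun p x \<le> a\<close> says that x/a lies in that set.\<close>

lemma op_fun_scaleR:
  assumes "p > 0"
  shows "op_fun p (c *\<^sub>R x) = \<bar>c\<bar> * op_fun p x"
proof -
  have "mean_powr p (c *\<^sub>R x) = \<bar>c\<bar> powr p * mean_powr p x"
    by (simp add: mean_powr_def abs_mult powr_mult sum_distrib_left)
  then show ?thesis
    using assms by (simp add: op_fun_eq_mean_powr powr_mult powr_powr)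
qed

lemma powr_convex_atLeast:
  fixes p :: real
  assumes "p \<ge> 1"
  shows "convex_on {0..} (\<lambda>x. x powr p)"
proof (rule convex_on_linorderI)
  fix t x y :: real
  assume t: "0 < t" "t < 1" and xy: "x \<in> {0..}" "y \<in> {0..}" "x < y"
  show "((1 - t) *\<^sub>R x + t *\<^sub>R y) powr p \<le> (1 - t) * x powr p + t * y powr p"
  \<comment> \<open>\<open>powr_convex\<close> handles positive arguments. Since
    \<open>x < y\<close>, only \<open>x\<close> can be 0, and then the claim reduces to t^p \<le>
    t.\<close>
  proof (cases "x = 0")
    case True
    have "t powr p \<le> t powr 1"
      using t assms by (intro powr_mono') auto
    then show ?thesis
      using True t xy by (simp add: powr_mult mult_right_mono)
  next
    case False
    then show ?thesis
      using convex_onD[OF powr_convex[OF assms], of t x y] t xy by auto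
  qed
qed simp

text \<open>Each summand composes the convex absolute value with a power that is increasing and
  convex on the nonnegative reals.\<close>

lemma convex_on_mean_powr:
  fixes p :: real
  assumes "p \<ge> 1"
  shows "convex_on UNIV (mean_powr p :: real ^ 'n \<Rightarrow> real)"
proof (rule convex_onI)
  fix t :: real and x y :: "real ^ 'n"
  assume t: "0 < t" "t < 1"
  have "\<bar>((1 - t) *\<^sub>R x + t *\<^sub>R y) $ i\<bar> powr p
      \<le> (1 - t) * \<bar>x $ i\<bar> powr p + t * \<bar>y $ i\<bar> powr p" for i
  proof -
    have "\<bar>((1 - t) *\<^sub>R x + t *\<^sub>R y) $ i\<bar> \<le> (1 - t) * \<bar>x $ i\<bar> + t * \<bar>y $ i\<bar>"
      using t abs_triangle_ineq[of "(1 - t) * x $ i" "t * y $ i"] by (simp add: abs_mult)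
    then have "\<bar>((1 - t) *\<^sub>R x + t *\<^sub>R y) $ i\<bar> powr p
        \<le> ((1 - t) * \<bar>x $ i\<bar> + t * \<bar>y $ i\<bar>) powr p"
      using assms by (intro powr_mono2) auto
    also have "\<dots> \<le> (1 - t) * \<bar>x $ i\<bar> powr p + t * \<bar>y $ i\<bar> powr p"
      using convex_onD[OF powr_convex_atLeast[OF assms], of t "\<bar>x $ i\<bar>" "\<bar>y $ i\<bar>"] t by simp
    finally show ?thesis .
  qed
  then have "(\<Sum>i\<in>UNIV. \<bar>((1 - t) *\<^sub>R x + t *\<^sub>R y) $ i\<bar> powr p)
      \<le> (1 - t) * (\<Sum>i\<in>UNIV. \<bar>x $ i\<bar> powr p) + t * (\<Sum>i\<in>UNIV. \<bar>y $ i\<bar> powr p)"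
    unfolding sum_distrib_left sum.distrib[symmetric] by (rule sum_mono)
  then show "mean_powr p ((1 - t) *\<^sub>R x + t *\<^sub>R y) \<le> (1 - t) * mean_powr p x + t * mean_powr p y"
    unfolding mean_powr_def times_divide_eq_right add_divide_distrib[symmetric]
    by (rule divide_right_mono) simp
qed simp

lemma convex_on_op_fun:
  fixes p :: real
  assumes "p \<ge> 1"
  shows "convex_on UNIV (op_fun p :: real ^ 'n \<Rightarrow> real)"
proof (rule convex_onI)
  fix t :: real and x y :: "real ^ 'n"
  assume t: "0 < t" "t < 1"
  have p: "p > 0"
    using assms by simp
  show "op_fun p ((1 - t) *\<^sub>R x + t *\<^sub>R y) \<le> (1 - t) * op_fun p x + t * op_fun p y"
  \<comment> \<open>The slack \<open>e\<close> keeps \<open>a\<close> and \<open>b\<close> positive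
    even where \<open>op_fun\<close> vanishes, so that \<open>x\<close> and \<open>y\<close> can be
    divided by them.\<close>
  proof (rule field_le_epsilon)
    fix e :: real
    assume e: "e > 0"
    define a where "a = op_fun p x + e"
    define b where "b = op_fun p y + e"
    define c where "c = (1 - t) * a + t * b"
    have ab: "a > 0" "b > 0"
      using e by (auto simp: a_def b_def op_fun_eq_mean_powr intro: add_nonneg_pos)
    have c: "c > 0"
      using ab t by (simp add: c_def add_pos_pos)
    have x: "mean_powr p ((1 / a) *\<^sub>R x) \<le> 1" and y: "mean_powr p ((1 / b) *\<^sub>R y) \<le> 1"
      using ab e by (simp_all add: op_fun_le_1_iff[OF p, symmetric] op_fun_scaleR[OF p] a_def b_def)
    \<comment> \<open>This weight turns the combination of \<open>x\<close> and \<open>y\<close>,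
      divided by \<open>c\<close>, into a convex combination of the points x/a and y/b of the
      sublevel set.\<close>
    define s where "s = t * b / c"
    have s: "0 \<le> s" "s \<le> 1" and s': "1 - s = (1 - t) * a / c"
      using t ab c by (auto simp: s_def field_simps c_def)
    have "(1 / c) *\<^sub>R ((1 - t) *\<^sub>R x + t *\<^sub>R y)
        = (1 - s) *\<^sub>R ((1 / a) *\<^sub>R x) + s *\<^sub>R ((1 / b) *\<^sub>R y)"
      unfolding s' using ab by (simp add: s_def scaleR_add_right)
    also have "mean_powr p \<dots>
        \<le> (1 - s) * mean_powr p ((1 / a) *\<^sub>R x) + s * mean_powr p ((1 / b) *\<^sub>R y)"
      using convex_onD[OF convex_on_mean_powr[OF assms]] s by blast
    also have "\<dots> \<le> 1"
      using x y s by (intro convex_bound_le) auto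
    finally have "op_fun p ((1 / c) *\<^sub>R ((1 - t) *\<^sub>R x + t *\<^sub>R y)) \<le> 1"
      by (simp only: op_fun_le_1_iff[OF p])
    then have "op_fun p ((1 - t) *\<^sub>R x + t *\<^sub>R y) \<le> c"
      unfolding op_fun_scaleR[OF p] using c by simp
    then show "op_fun p ((1 - t) *\<^sub>R x + t *\<^sub>R y) \<le> (1 - t) * op_fun p x + t * op_fun p y + e"
      by (simp add: c_def a_def b_def algebra_simps)
  qed
qed simp

lemma unit_box_subset_Op_set:
  assumes "p > 0"
  shows "unit_box \<subseteq> (Op_set p :: (real ^ 'n) set)"
proof
  fix x :: "real ^ 'n"
  assume "x \<in> unit_box"
  then have "\<bar>x $ i\<bar> powr p \<le> 1" for i
    using assms component_le_infnorm_cart[of x i] by (intro powr_le1) (auto simp: unit_box_def)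
  then have "(\<Sum>i\<in>UNIV. \<bar>x $ i\<bar> powr p) \<le> (\<Sum>i\<in>(UNIV :: 'n set). 1)"
    by (rule sum_mono)
  then show "x \<in> Op_set p"
    using assms by (simp add: Op_set_def op_fun_le_1_iff mean_powr_def)
qed

lemma Op_set_antimono:
  assumes "0 < p" "p \<le> q"
  shows "(Op_set q :: (real ^ 'n) set) \<subseteq> Op_set p"
proof
  fix x :: "real ^ 'n"
  assume "x \<in> Op_set q"
  then have q: "mean_powr q x \<le> 1"
    using assms by (simp add: Op_set_def op_fun_le_1_iff)
  define r where "r = p / q"
  have r: "0 \<le> r" "r \<le> 1" "q * r = p"
    using assms by (auto simp: r_def)
  have "\<bar>x $ i\<bar> powr p \<le> r * \<bar>x $ i\<bar> powr q + (1 - r)" for i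
    \<comment> \<open>Weighted AM-GM for the numbers \<open>\<bar>x $ i\<bar> powr q\<close> and 1,
      where \<open>q * r = p\<close> gives the left side. It needs positive numbers; for
      \<open>x $ i = 0\<close> the claim is 0 \<le> 1 - r.\<close>
    using Youngs_inequality_0[of r "1 - r" "\<bar>x $ i\<bar> powr q" 1] r
    by (cases "x $ i = 0") (auto simp: powr_powr)
  then have "(\<Sum>i\<in>UNIV. \<bar>x $ i\<bar> powr p) \<le> (\<Sum>i\<in>UNIV. r * \<bar>x $ i\<bar> powr q + (1 - r))"
    by (rule sum_mono)
  also have "\<dots> = real CARD('n) * (r * mean_powr q x + (1 - r))"
    by (simp add: sum.distrib mean_powr_def sum_distrib_left[symmetric] distrib_left)
  \<comment> \<open>A convex combination of \<open>mean_powr q x\<close> and 1 is at most 1, because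
    \<open>mean_powr q x\<close> is.\<close>
  also have "\<dots> \<le> real CARD('n) * 1"
    using mult_left_mono[OF q r(1)] by (intro mult_left_mono) auto
  finally show "x \<in> Op_set p"
    using assms by (simp add: Op_set_def op_fun_le_1_iff mean_powr_def)
qed

theorem mainTheorem1:
  shows "(\<forall>\<alpha>\<in>{2..}. convex_on UNIV (op_fun \<alpha> :: real ^ 'n \<Rightarrow> real)) \<and>
    (\<forall>\<alpha>\<in>{2..}. (unit_box :: (real ^ 'n) set) \<subseteq> Op_set \<alpha>) \<and>
    (\<forall>\<alpha>\<^sub>1\<in>{2..}. \<forall>\<alpha>\<^sub>2\<in>{2..}. \<alpha>\<^sub>2 \<ge> \<alpha>\<^sub>1 \<longrightarrow>
       (Op_set \<alpha>\<^sub>2 :: (real ^ 'n) set) \<subseteq> Op_set \<alpha>\<^sub>1)"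
proof (intro conjI ballI impI)
  show "convex_on UNIV (op_fun \<alpha> :: real ^ 'n \<Rightarrow> real)" if "\<alpha> \<in> {2..}" for \<alpha>
    using that by (intro convex_on_op_fun) simp
  show "(unit_box :: (real ^ 'n) set) \<subseteq> Op_set \<alpha>" if "\<alpha> \<in> {2..}" for \<alpha>
    using that by (intro unit_box_subset_Op_set) simp
  show "(Op_set \<alpha>\<^sub>2 :: (real ^ 'n) set) \<subseteq> Op_set \<alpha>\<^sub>1"
    if "\<alpha>\<^sub>1 \<in> {2..}" "\<alpha>\<^sub>2 \<ge> \<alpha>\<^sub>1" for \<alpha>\<^sub>1 \<alpha>\<^sub>2
    using that by (intro Op_set_antimono) simp_all
qed

end
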